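(* Suppose $W$ is a nonnegative random variable, $(a_n)_{n\in\mathbb{N}}$ is a positive sequence such that $a_n/n\to1$ as $n\to\infty$, $W/a_n\in\mathbb{B}(n)$ for each $n\ge1$, and $\mathbb{E}e^{\epsilon W}<\infty$ for some $\epsilon>0$. Then $$(W/a_n)\circ n\Rightarrow N(W)\qquad\text{as }n\to\infty.$$
   Context: Notation. $\Rightarrow$ denotes convergence in distribution. For $n\ge1$, $\mathbb{B}(n)$ is the set of (distributions of) nonnegative random variables $V$ with $\mathbb{E}V^n<\infty$ and $\mathbb{E}[V^k(1-V)^{n-k}]\ge0$ for every $k\in\{0,1,\ldots,n\}$ with $n-k$ odd (with $x^0=1$ for all $x$). For $V\in\mathbb{B}(n)$, $V\circ n$ denotes a random variable with distribution $P(V\circ n=k)=\binom nk\mathbb{E}[V^k(1-V)^{n-k}]$, $k=0,1,\ldots,n$ (equivalently, with $\mathbb{E}(1-s)^{V\circ n}=\mathbb{E}(1-sV)^n$). $\{N(t):t\ge0\}$ is a rate-$1$ Poisson process independent of $W$, so that given $W$, $N(W)$ is Poisson with mean $W$ (constant $0$ when $W=0$). *)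

theory Defs
  imports "HOL-Probability.Probability"
begin

text \<open>
  Laws on the nonnegative half-line with finite $n$-th moment. For $n - k$ even the integrand below
  is nonnegative anyway, so the sign condition is only imposed for $n - k$ odd.
\<close>

definition BB :: "nat \<Rightarrow> real measure set" where
  "BB n = {\<mu>. real_distribution \<mu> \<and> (AE v in \<mu>. 0 \<le> v) \<and> integrable \<mu> (\<lambda>v. v ^ n) \<and>
     (\<forall>k\<in>{0..n}. odd (n - k) \<longrightarrow> 0 \<le> (\<integral>v. v ^ k * (1 - v) ^ (n - k) \<partial>\<mu>))}"

text \<open>
  The law of $V \circ n$ when $V$ has law \<open>\<mu>\<close>. As \<open>embed_pmf\<close> is specified only on
  probability mass functions, this is meaningful only for \<open>\<mu> \<in> BB n\<close>; see \<open>pmf_circ\<close> below.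
\<close>

definition circ :: "real measure \<Rightarrow> nat \<Rightarrow> nat pmf" where
  "circ \<mu> n = embed_pmf (\<lambda>k. real (n choose k) * (\<integral>v. v ^ k * (1 - v) ^ (n - k) \<partial>\<mu>))"

text \<open>
  The path conditions are required on the whole sample space, which makes the random time change
  \<open>\<lambda>\<omega>. N (W \<omega>) \<omega>\<close> measurable. Since paths are nondecreasing, the truncated subtraction on
  \<^typ>\<open>nat\<close> gives the true increments.
\<close>

definition poisson_process :: "real \<Rightarrow> 'a measure \<Rightarrow> (real \<Rightarrow> 'a \<Rightarrow> nat) \<Rightarrow> bool" where
  "poisson_process rate M N \<longleftrightarrow>
     0 < rate \<and> prob_space M \<and>
     (\<forall>t\<ge>0. N t \<in> measurable M (count_space UNIV)) \<and>
     (\<forall>\<omega>\<in>space M. N 0 \<omega> = 0 \<and> mono_on {0..} (\<lambda>t. N t \<omega>) \<and>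
        (\<forall>t\<ge>0. ((\<lambda>s. N s \<omega>) \<longlongrightarrow> N t \<omega>) (at_right t))) \<and>
     (\<forall>s t. 0 \<le> s \<and> s < t \<longrightarrow>
        distr M (count_space UNIV) (\<lambda>\<omega>. N t \<omega> - N s \<omega>) =
        measure_pmf (poisson_pmf (rate * (t - s)))) \<and>
     (\<forall>(\<tau> :: nat \<Rightarrow> real) m. 0 \<le> \<tau> 0 \<and> mono \<tau> \<longrightarrow>
        prob_space.indep_vars M (\<lambda>_. count_space UNIV) (\<lambda>i \<omega>. N (\<tau> (Suc i)) \<omega> - N (\<tau> i) \<omega>) {..<m})"

text \<open>
  Independence of two random elements; unlike \<open>indep_var\<close>, their value spaces may have different
  types.
\<close>

definition indep_elements ::
    "'a measure \<Rightarrow> 'b measure \<Rightarrow> ('a \<Rightarrow> 'b) \<Rightarrow> 'c measure \<Rightarrow> ('a \<Rightarrow> 'c) \<Rightarrow> bool" where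
  "indep_elements M S X T Y \<longleftrightarrow>
     X \<in> measurable M S \<and> Y \<in> measurable M T \<and>
     prob_space.indep_set M {X -` A \<inter> space M | A. A \<in> sets S} {Y -` B \<inter> space M | B. B \<in> sets T}"

lemma (in prob_space) indep_elements_iff_indep_var:
  "indep_elements M S X T Y \<longleftrightarrow> indep_var S X T Y"
proof -
  have *: "sigma_sets (space M) {Z -` A \<inter> space M | A. A \<in> sets R} = {Z -` A \<inter> space M | A. A \<in> sets R}"
    if "Z \<in> measurable M R" for Z :: "'a \<Rightarrow> 'b" and R
    using sets_vimage_algebra2[of Z "space M" R] that
    by (simp add: sets_vimage_algebra measurable_def)
  show ?thesis
    unfolding indep_elements_def indep_var_eq
    by (cases "random_variable S X \<and> random_variable T Y") (auto simp: *)
qed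

lemma integrable_BB:
  assumes "\<mu> \<in> BB n" "k \<le> n"
  shows "integrable \<mu> (\<lambda>v. v ^ k * (1 - v) ^ (n - k))"
proof -
  interpret real_distribution \<mu> using assms by (simp add: BB_def)
  have nonneg: "AE v in \<mu>. 0 \<le> v" and int: "integrable \<mu> (\<lambda>v. v ^ n)"
    using assms by (simp_all add: BB_def)
  show ?thesis
  proof (rule Bochner_Integration.integrable_bound[of _ "\<lambda>v. 1 + v ^ n"])
    show "AE v in \<mu>. norm (v ^ k * (1 - v) ^ (n - k)) \<le> norm (1 + v ^ n)"
      using nonneg
    proof eventually_elim
      case (elim v)
      let ?m = "max 1 v"
      have "norm (v ^ k * (1 - v) ^ (n - k)) = \<bar>v\<bar> ^ k * \<bar>1 - v\<bar> ^ (n - k)"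
        by (simp add: abs_mult power_abs)
      also have "\<dots> \<le> ?m ^ k * ?m ^ (n - k)"
        using elim by (intro mult_mono power_mono) auto
      also have "\<dots> = ?m ^ n" using assms(2) by (simp flip: power_add)
      also have "\<dots> \<le> 1 + v ^ n" using elim by (auto simp: max_def)
      finally show ?case using elim by simp
    qed
  qed (use int in auto)
qed

lemma nonneg_BB:
  assumes "\<mu> \<in> BB n" "k \<le> n"
  shows "0 \<le> (\<integral>v. v ^ k * (1 - v) ^ (n - k) \<partial>\<mu>)"
proof (cases "odd (n - k)")
  case False
  have "AE v in \<mu>. 0 \<le> v" using assms by (simp add: BB_def)
  then have "AE v in \<mu>. 0 \<le> v ^ k * (1 - v) ^ (n - k)"
    by eventually_elim (use False in \<open>simp add: zero_le_even_power\<close>)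
  then show ?thesis by (rule integral_nonneg_AE)
qed (use assms in \<open>auto simp: BB_def\<close>)

lemma pmf_circ:
  assumes "\<mu> \<in> BB n"
  shows "pmf (circ \<mu> n) k = real (n choose k) * (\<integral>v. v ^ k * (1 - v) ^ (n - k) \<partial>\<mu>)"
proof -
  interpret real_distribution \<mu> using assms by (simp add: BB_def)
  let ?f = "\<lambda>k. real (n choose k) * (\<integral>v. v ^ k * (1 - v) ^ (n - k) \<partial>\<mu>)"
  have nn: "0 \<le> ?f k" for k
    by (cases "k \<le> n") (simp_all add: nonneg_BB[OF assms] binomial_eq_0)
  have "(\<Sum>k\<le>n. ?f k) = (\<Sum>k\<le>n. (\<integral>v. real (n choose k) * (v ^ k * (1 - v) ^ (n - k)) \<partial>\<mu>))"
    by simp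
  also have "\<dots> = (\<integral>v. (\<Sum>k\<le>n. real (n choose k) * (v ^ k * (1 - v) ^ (n - k))) \<partial>\<mu>)"
    by (rule Bochner_Integration.integral_sum[symmetric])
       (auto intro: integrable_BB[OF assms])
  also have "\<dots> = (\<integral>v. (v + (1 - v)) ^ n \<partial>\<mu>)"
    by (simp only: binomial_ring mult.assoc of_nat_id)
  also have "\<dots> = 1" by (simp add: prob_space[simplified])
  finally have sum: "(\<Sum>k\<le>n. ?f k) = 1" .
  have "(\<integral>\<^sup>+k. ennreal (?f k) \<partial>count_space UNIV) = (\<Sum>k\<le>n. ennreal (?f k))"
    by (rule nn_integral_count_space') (auto simp: binomial_eq_0)
  also have "\<dots> = ennreal (\<Sum>k\<le>n. ?f k)" by (rule sum_ennreal) (rule nn)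
  finally have "(\<integral>\<^sup>+k. ennreal (?f k) \<partial>count_space UNIV) = 1" using sum by simp
  then show ?thesis unfolding circ_def by (intro pmf_embed_pmf nn) auto
qed

end

theory Submission
  imports Defs "HOL-Complex_Analysis.Conformal_Mappings"
begin

text \<open>
  Everything is read off from probability generating functions. The defining property of
  \<open>V \<circ> n\<close> is \<open>E z^(V \<circ> n) = E (1 - (1 - z) V)^n\<close> (lemma \<open>circ_pgf\<close>), so for
  \<open>V = W / a\<^sub>n\<close> and \<open>s = 1 - z\<close> the generating function is \<open>E (1 - s W / a\<^sub>n)^n\<close>. Its
  integrand tends to \<open>exp (- s W)\<close>, and \<open>E exp (- s W)\<close> is the generating function of
  \<open>N(W)\<close> at \<open>z\<close> (lemma \<open>mixed_poisson_pgf\<close>).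

  Passing to the limit under the expectation needs a dominating function. As \<open>W\<close> may exceed
  \<open>a\<^sub>n\<close>, the integrand is not bounded by 1, but for \<open>0 \<le> s\<close> it is at most
  \<open>exp (s (n / a\<^sub>n) W)\<close> in absolute value. The exponential moment dominates this for large
  \<open>n\<close> as long as \<open>s < \<epsilon>\<close> (lemma \<open>circ_scaled_pgf_tendsto\<close>). Hence the generating
  functions converge only for \<open>z\<close> in an interval whose right end point is 1, possibly a short
  one and far from the origin, where the coefficients live.

  Such an interval nevertheless determines the limit: the coefficients lie in \<open>[0, 1]\<close>, so every
  subsequence has a further one along which all of them converge, the generating functions converge
  along with them, and by the identity theorem the limiting coefficients can only be those of
  \<open>N(W)\<close> (lemma \<open>power_series_convergence_imp_coefficient_convergence\<close>). For integer-valued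
  variables convergence of the point masses gives convergence of the distribution functions.

  It remains to identify the law of \<open>N(W)\<close> from the independence of \<open>W\<close> and the process.
  Evaluation of a path at a time is not jointly measurable on the product space of all paths, so
  conditioning on \<open>W\<close> is not directly possible. Instead \<open>W\<close> is approximated from above by
  discrete times, for which the law is a countable sum, and right-continuity of the
  integer-valued paths makes \<open>N\<close> at these times eventually equal to \<open>N(W)\<close>
  (lemma \<open>poisson_process_at_random_time\<close>).
\<close>

section \<open>Power series with bounded coefficients\<close>

text \<open>
  Boundedness of the coefficients makes the series holomorphic in the unit disc, and the interval
  has a limit point there, so the identity theorem applies.
\<close>
lemma power_series_zero_on_interval:
  fixes c :: "nat \<Rightarrow> real"
  assumes bounded: "\<And>k. \<bar>c k\<bar> \<le> B" and uv: "0 \<le> u" "u < v" "v \<le> 1"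
    and zero: "\<And>z. u < z \<Longrightarrow> z < v \<Longrightarrow> (\<Sum>k. c k * z ^ k) = 0"
  shows "c k = 0"
proof -
  define f where "f = (\<lambda>w::complex. \<Sum>k. of_real (c k) * w ^ k)"
  have sums_f: "(\<lambda>k. of_real (c k) * (w - 0) ^ k) sums f w" if "w \<in> ball 0 1" for w :: complex
  proof -
    have "summable (\<lambda>k. of_real (c k) * w ^ k)"
    proof (rule summable_comparison_test')
      show "summable (\<lambda>k. B * norm w ^ k)"
        using that by (intro summable_mult summable_geometric) simp
      show "norm (of_real (c k) * w ^ k) \<le> B * norm w ^ k" for k
        using bounded[of k] by (simp add: norm_mult norm_power mult_right_mono)
    qed
    then show ?thesis by (simp add: f_def summable_sums)
  qed
  define m where "m = (u + v) / 2"
  have m: "u < m" "m < v" using uv by (simp_all add: m_def)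
  define U where "U = of_real ` {u<..<v} \<inter> (ball 0 1 :: complex set)"
  have f_zero: "f w = 0" if "w \<in> ball 0 1" for w
  proof (rule analytic_continuation[where S = "ball 0 1" and U = U and f = f])
    show "f holomorphic_on ball 0 1"
      using sums_f by (rule power_series_holomorphic)
    show "U \<subseteq> ball 0 1" by (simp add: U_def)
    show "of_real m \<in> ball (0::complex) 1" using m uv by simp
    show "of_real m islimpt U"
    proof (rule islimptI)
      fix T :: "complex set" assume T: "of_real m \<in> T" "open T"
      then obtain e where e: "e > 0" "ball (of_real m) e \<subseteq> T" by (meson openE)
      \<comment> \<open>A point to the right of \<open>m\<close>, close enough to lie in both the interval and \<open>T\<close>.\<close>
      define x where "x = min ((m + v) / 2) (m + e / 2)"
      have x: "m < x" "x < v" "x < m + e" using m e by (auto simp: x_def min_def)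
      have "dist (of_real m :: complex) (of_real x) = x - m"
        using x by (simp add: dist_norm norm_minus_commute flip: of_real_diff)
      then have "complex_of_real x \<in> ball (of_real m) e"
        using x by simp
      then have "complex_of_real x \<in> T" using e by blast
      moreover have "complex_of_real x \<in> U"
        using x m uv by (auto simp: U_def)
      ultimately show "\<exists>y\<in>U. y \<in> T \<and> y \<noteq> complex_of_real m" using x by auto
    qed
    show "f w = 0" if "w \<in> U" for w
    proof -
      from that obtain x where x: "w = of_real x" "u < x" "x < v" by (auto simp: U_def)
      have "f w = (\<Sum>k. complex_of_real (c k * x ^ k))" by (simp add: f_def x)
      also have "\<dots> = of_real (\<Sum>k. c k * x ^ k)"
      proof (rule suminf_of_real[symmetric])
        have "summable (\<lambda>k. complex_of_real (c k * x ^ k))"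
          using sums_f[of w] x that by (auto simp: U_def sums_iff)
        then show "summable (\<lambda>k. c k * x ^ k)" using summable_of_real_iff by blast
      qed
      finally show ?thesis using zero x by simp
    qed
  qed (use that in auto)
  \<comment> \<open>Isolation of zeros below needs a nonzero coefficient of positive index.\<close>
  have c0: "c 0 = 0"
  proof -
    have "f 0 = of_real (c 0)"
      using powser_sums_zero[of "\<lambda>k. complex_of_real (c k)"] sums_f[of 0] by (auto dest: sums_unique2)
    then show ?thesis using f_zero[of 0] by simp
  qed
  show ?thesis
  proof (rule ccontr)
    assume k: "c k \<noteq> 0"
    then have "k > 0" using c0 by (cases k) auto
    with k obtain s where s: "0 < s" "\<And>z. z \<in> cball 0 s - {0} \<Longrightarrow> f z \<noteq> 0"
      using powser_0_nonzero[of 1 0 "\<lambda>k. complex_of_real (c k)" f k] sums_f f_zero by auto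
    have "f (of_real (min s (1/2))) \<noteq> 0" using s(1) by (intro s(2)) (auto simp: min_def)
    moreover have "f (of_real (min s (1/2))) = 0" using s(1) by (intro f_zero) (auto simp: min_def)
    ultimately show False by simp
  qed
qed

text \<open>
  By compactness of \<open>[0, 1]\<^sup>\<nat>\<close>, a subsequence staying away from \<open>q\<close> in coordinate \<open>k\<close> would
  have a further subsequence converging in all coordinates. Tannery's theorem transfers that
  convergence to the power series, so its limit has the same sums as \<open>q\<close> on the interval and
  is \<open>q\<close> by the identity theorem.
\<close>
lemma power_series_convergence_imp_coefficient_convergence:
  fixes p :: "nat \<Rightarrow> nat \<Rightarrow> real" and q :: "nat \<Rightarrow> real"
  assumes p: "\<And>n k. 0 \<le> p n k" "\<And>n k. p n k \<le> 1" and q: "\<And>k. 0 \<le> q k" "\<And>k. q k \<le> 1"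
    and uv: "0 \<le> u" "u < v" "v \<le> 1"
    and conv: "\<And>z. u < z \<Longrightarrow> z < v \<Longrightarrow> (\<lambda>n. \<Sum>k. p n k * z ^ k) \<longlonglongrightarrow> (\<Sum>k. q k * z ^ k)"
  shows "(\<lambda>n. p n k) \<longlonglongrightarrow> q k"
proof (rule ccontr)
  assume "\<not> ?thesis"
  then obtain e where e: "e > 0" "\<not> (\<forall>\<^sub>F n in sequentially. dist (p n k) (q k) < e)"
    unfolding tendsto_iff by blast
  obtain r :: "nat \<Rightarrow> nat" where r: "strict_mono r" and away: "\<And>n. \<not> dist (p (r n) k) (q k) < e"
    using not_eventually_sequentiallyD[OF e(2)] by blast
  have "compact (PiE UNIV (\<lambda>_::nat. {0..1::real}))"
    using compactin_PiE[of "\<lambda>_::nat. euclideanreal" UNIV "\<lambda>_. {0..1::real}"]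
    by (simp add: euclidean_product_topology)
  then have "seq_compact (PiE UNIV (\<lambda>_::nat. {0..1::real}))"
    by (rule compact_imp_seq_compact)
  moreover have "\<forall>n. (p \<circ> r) n \<in> PiE UNIV (\<lambda>_::nat. {0..1::real})"
    using p by auto
  ultimately obtain l s where l: "l \<in> PiE UNIV (\<lambda>_::nat. {0..1::real})"
    and s: "strict_mono (s :: nat \<Rightarrow> nat)" and lim: "((p \<circ> r) \<circ> s) \<longlonglongrightarrow> l"
    by (rule seq_compactE)
  have l01: "0 \<le> l j" "l j \<le> 1" for j using l by (auto simp: PiE_def)
  have lim_j: "(\<lambda>n. p (r (s n)) j) \<longlonglongrightarrow> l j" for j
    using continuous_on_tendsto_compose[OF continuous_on_product_coordinates lim, of j]
    by (simp add: o_def)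
  have "l j - q j = 0" for j
  proof (rule power_series_zero_on_interval[where B = 1 and u = u and v = v])
    show "\<bar>l i - q i\<bar> \<le> 1" for i using l01[of i] q(1)[of i] q(2)[of i] by (simp add: abs_le_iff)
    fix z :: real assume z: "u < z" "z < v"
    have z01: "0 < z" "z < 1" using z uv by auto
    have geom: "summable (\<lambda>k. z ^ k)" using z01 by (intro summable_geometric) simp
    have summ: "summable (\<lambda>k. g k * z ^ k)" if "\<And>k. 0 \<le> g k" "\<And>k. g k \<le> 1" for g :: "nat \<Rightarrow> real"
      using geom by (rule summable_comparison_test') (use that z01 in \<open>auto simp: abs_mult mult_left_le_one_le\<close>)
    have "(\<lambda>n. \<Sum>k. p (r (s n)) k * z ^ k) \<longlonglongrightarrow> (\<Sum>k. l k * z ^ k)"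
    proof (rule tannerys_theorem[THEN conjunct2, THEN conjunct2])
      show "(\<lambda>n. p (r (s n)) k * z ^ k) \<longlonglongrightarrow> l k * z ^ k" for k
        by (intro tendsto_mult lim_j tendsto_const)
      show "\<forall>\<^sub>F (k, n) in at_top \<times>\<^sub>F sequentially. norm (p (r (s n)) k * z ^ k) \<le> z ^ k"
        using p z01 by (intro always_eventually) (auto simp: abs_mult mult_left_le_one_le)
    qed (use geom in auto)
    moreover have "(\<lambda>n. \<Sum>k. p (r (s n)) k * z ^ k) \<longlonglongrightarrow> (\<Sum>k. q k * z ^ k)"
      using LIMSEQ_subseq_LIMSEQ[OF conv[OF z] strict_mono_o[OF r s]] by (simp add: o_def)
    ultimately have "(\<Sum>k. l k * z ^ k) = (\<Sum>k. q k * z ^ k)" by (rule LIMSEQ_unique)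
    then show "(\<Sum>k. (l k - q k) * z ^ k) = 0"
      using suminf_diff[OF summ[of l] summ[of q]] l01 q by (simp add: left_diff_distrib)
  qed (use uv in auto)
  then have "(\<lambda>n. p (r (s n)) k) \<longlonglongrightarrow> q k" using lim_j[of k] by simp
  then have "\<forall>\<^sub>F n in sequentially. dist (p (r (s n)) k) (q k) < e"
    using e(1) by (rule tendstoD)
  then show False using away by (auto simp: eventually_sequentially)
qed

section \<open>Convergence in distribution on the natural numbers\<close>

text \<open>
  A distribution function at \<open>x\<close> is the sum of the finitely many point masses up to \<open>x\<close>.
\<close>
lemma weak_conv_m_nat_valued:
  fixes \<mu> :: "nat \<Rightarrow> nat pmf" and X :: "'a \<Rightarrow> nat"
  assumes "prob_space M" and X: "X \<in> measurable M (count_space UNIV)"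
    and conv: "\<And>k. (\<lambda>n. pmf (\<mu> n) k) \<longlonglongrightarrow> measure M {\<omega>\<in>space M. X \<omega> = k}"
  shows "weak_conv_m (\<lambda>n. distr (measure_pmf (\<mu> n)) borel real) (distr M borel (\<lambda>\<omega>. real (X \<omega>)))"
  unfolding weak_conv_m_def weak_conv_def
proof (intro allI impI)
  interpret prob_space M by fact
  fix x :: real
  define S where "S = {k. real k \<le> x}"
  have "S \<subseteq> {..nat \<lfloor>x\<rfloor>}" by (auto simp: S_def le_nat_floor)
  then have fin: "finite S" using finite_subset by blast
  have "cdf (distr (measure_pmf (\<mu> n)) borel real) x = (\<Sum>k\<in>S. pmf (\<mu> n) k)" for n
    using measure_measure_pmf_finite[OF fin]
    by (simp add: cdf_def measure_distr vimage_def S_def)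
  moreover have "cdf (distr M borel (\<lambda>\<omega>. real (X \<omega>))) x = (\<Sum>k\<in>S. measure M {\<omega>\<in>space M. X \<omega> = k})"
  proof -
    have "(\<lambda>\<omega>. real (X \<omega>)) \<in> borel_measurable M"
      using measurable_compose[OF X, of real borel] by simp
    then have "cdf (distr M borel (\<lambda>\<omega>. real (X \<omega>))) x = measure M ((\<lambda>\<omega>. real (X \<omega>)) -` {..x} \<inter> space M)"
      by (simp add: cdf_def measure_distr)
    also have "(\<lambda>\<omega>. real (X \<omega>)) -` {..x} \<inter> space M = (\<Union>k\<in>S. {\<omega>\<in>space M. X \<omega> = k})"
      by (auto simp: S_def)
    also have "measure M \<dots> = (\<Sum>k\<in>S. measure M {\<omega>\<in>space M. X \<omega> = k})"
    proof (rule finite_measure_finite_Union[OF fin])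
      have "{\<omega>\<in>space M. X \<omega> = k} = X -` {k} \<inter> space M" for k by auto
      then show "(\<lambda>k. {\<omega> \<in> space M. X \<omega> = k}) ` S \<subseteq> events"
        using measurable_sets[OF X] by auto
    qed (auto simp: disjoint_family_on_def)
    finally show ?thesis .
  qed
  ultimately show "(\<lambda>n. cdf (distr (measure_pmf (\<mu> n)) borel real) x)
      \<longlonglongrightarrow> cdf (distr M borel (\<lambda>\<omega>. real (X \<omega>))) x"
    using conv by (simp add: tendsto_sum)
qed

section \<open>A Poisson process at an independent random time\<close>

text \<open>
  The event \<open>N t = k\<close> is measurable in path space, so it inherits independence of \<open>W\<close>. The law of
  \<open>N t\<close> is that of the increment over \<open>[0, t]\<close>, which is why \<open>t\<close> has to be positive.
\<close>
lemma poisson_process_marginal_indep: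
  assumes P: "poisson_process 1 M N"
    and indep: "indep_elements M S W (\<Pi>\<^sub>M t\<in>{0..}. count_space UNIV) (\<lambda>\<omega>. \<lambda>t\<in>{0..}. N t \<omega>)"
    and t: "0 < t" and B: "B \<in> sets S"
  shows "measure M {\<omega>\<in>space M. W \<omega> \<in> B \<and> N t \<omega> = k}
           = measure M {\<omega>\<in>space M. W \<omega> \<in> B} * (t ^ k / fact k * exp (- t))"
proof -
  interpret prob_space M using P by (simp add: poisson_process_def)
  have N_meas: "N t \<in> measurable M (count_space UNIV)" and N0: "\<And>\<omega>. \<omega> \<in> space M \<Longrightarrow> N 0 \<omega> = 0"
    and incr: "distr M (count_space UNIV) (\<lambda>\<omega>. N t \<omega> - N 0 \<omega>) = measure_pmf (poisson_pmf (1 * (t - 0)))"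
    using P t unfolding poisson_process_def by (blast intro: less_imp_le)+
  have law: "prob {\<omega>\<in>space M. N t \<omega> = k} = t ^ k / fact k * exp (- t)"
  proof -
    have "distr M (count_space UNIV) (N t) = measure_pmf (poisson_pmf t)"
      using incr N0 distr_cong[of M M "count_space UNIV" "count_space UNIV" "N t" "\<lambda>\<omega>. N t \<omega> - N 0 \<omega>"]
      by simp
    moreover have "prob {\<omega>\<in>space M. N t \<omega> = k} = measure (distr M (count_space UNIV) (N t)) {k}"
      using N_meas by (subst measure_distr) (auto intro: arg_cong[where f = prob])
    ultimately show ?thesis using t by (simp add: measure_pmf_single)
  qed
  let ?Y = "\<lambda>\<omega>. \<lambda>t\<in>{0..}. N t \<omega>" and ?T = "\<Pi>\<^sub>M t\<in>{0::real..}. count_space (UNIV :: nat set)"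
  define C where "C = {f \<in> space ?T. f t = k}"
  have "C \<in> sets ?T"
  proof -
    have "(\<lambda>f. f t) \<in> measurable ?T (count_space UNIV)"
      using t by (intro measurable_component_singleton) auto
    from measurable_sets[OF this, of "{k}"] show ?thesis
      by (simp add: C_def vimage_def Int_def conj_commute)
  qed
  then have "prob ((W -` B \<inter> space M) \<inter> (?Y -` C \<inter> space M)) = prob (W -` B \<inter> space M) * prob (?Y -` C \<inter> space M)"
    using indep B unfolding indep_elements_def by (intro indep_setD) auto
  moreover have "?Y -` C \<inter> space M = {\<omega>\<in>space M. N t \<omega> = k}"
    using t by (auto simp: C_def space_PiM)
  moreover have "W -` B \<inter> space M = {\<omega>\<in>space M. W \<omega> \<in> B}" by auto
  moreover have "{\<omega>\<in>space M. W \<omega> \<in> B} \<inter> {\<omega>\<in>space M. N t \<omega> = k} = {\<omega>\<in>space M. W \<omega> \<in> B \<and> N t \<omega> = k}"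
    by auto
  ultimately show ?thesis using law by simp
qed

text \<open>
  Splitting the sample space along the countably many values of \<open>J (W \<omega>)\<close> reduces the random
  time to fixed ones.
\<close>
lemma poisson_process_at_discrete_time:
  fixes \<tau> :: "nat \<Rightarrow> real" and J :: "'b \<Rightarrow> nat"
  assumes P: "poisson_process 1 M N"
    and indep: "indep_elements M S W (\<Pi>\<^sub>M t\<in>{0..}. count_space UNIV) (\<lambda>\<omega>. \<lambda>t\<in>{0..}. N t \<omega>)"
    and J: "J \<in> measurable S (count_space UNIV)" and \<tau>: "\<And>j. 0 < \<tau> j"
  shows "(\<lambda>\<omega>. N (\<tau> (J (W \<omega>))) \<omega>) \<in> measurable M (count_space UNIV)"
    and "measure M {\<omega>\<in>space M. N (\<tau> (J (W \<omega>))) \<omega> = k}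
           = (\<integral>\<omega>. \<tau> (J (W \<omega>)) ^ k / fact k * exp (- \<tau> (J (W \<omega>))) \<partial>M)"
proof -
  interpret prob_space M using P by (simp add: poisson_process_def)
  have W: "W \<in> measurable M S" using indep by (simp add: indep_elements_def)
  have JW [measurable]: "(\<lambda>\<omega>. J (W \<omega>)) \<in> measurable M (count_space UNIV)"
    using W J by (rule measurable_compose)
  have N [measurable]: "N (\<tau> j) \<in> measurable M (count_space UNIV)" for j
    using P \<tau>[of j] by (simp add: poisson_process_def)
  show meas [measurable]: "(\<lambda>\<omega>. N (\<tau> (J (W \<omega>))) \<omega>) \<in> measurable M (count_space UNIV)"
    by (rule measurable_compose_countable[where f = "\<lambda>j \<omega>. N (\<tau> j) \<omega>"]) measurable
  define g where "g = (\<lambda>j. \<tau> j ^ k / fact k * exp (- \<tau> j))"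
  have g: "0 \<le> g j" for j using \<tau>[of j] by (simp add: g_def)
  define D where "D = (\<lambda>j. {\<omega>\<in>space M. J (W \<omega>) = j})"
  define A where "A = (\<lambda>j. {\<omega>\<in>space M. J (W \<omega>) = j \<and> N (\<tau> j) \<omega> = k})"
  have D_meas [measurable]: "D j \<in> events" for j unfolding D_def by measurable
  have A_meas [measurable]: "A j \<in> events" for j unfolding A_def by measurable
  have split: "emeasure M (A j) = ennreal (g j) * emeasure M (D j)" for j
  proof -
    have "J -` {j} \<inter> space S \<in> sets S" using J by (rule measurable_sets) simp
    from poisson_process_marginal_indep[OF P indep \<tau> this, of j k]
    have "prob {\<omega>\<in>space M. W \<omega> \<in> J -` {j} \<inter> space S \<and> N (\<tau> j) \<omega> = k}
      = prob {\<omega>\<in>space M. W \<omega> \<in> J -` {j} \<inter> space S} * g j" by (simp add: g_def)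
    moreover have "{\<omega>\<in>space M. W \<omega> \<in> J -` {j} \<inter> space S \<and> N (\<tau> j) \<omega> = k} = A j"
      using measurable_space[OF W] by (auto simp: A_def)
    moreover have "{\<omega>\<in>space M. W \<omega> \<in> J -` {j} \<inter> space S} = D j"
      using measurable_space[OF W] by (auto simp: D_def)
    ultimately show ?thesis using g[of j] by (simp add: emeasure_eq_measure ennreal_mult' mult.commute)
  qed
  have "emeasure M {\<omega>\<in>space M. N (\<tau> (J (W \<omega>))) \<omega> = k} = emeasure M (\<Union>j. A j)"
    by (rule arg_cong[where f = "emeasure M"]) (auto simp: A_def)
  also have "\<dots> = (\<Sum>j. emeasure M (A j))"
    by (rule suminf_emeasure[symmetric]) (auto simp: disjoint_family_on_def A_def intro: A_meas[unfolded A_def])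
  also have "\<dots> = (\<Sum>j. \<integral>\<^sup>+\<omega>. ennreal (g j) * indicator (D j) \<omega> \<partial>M)"
    by (simp add: split nn_integral_cmult_indicator)
  also have "\<dots> = (\<integral>\<^sup>+\<omega>. (\<Sum>j. ennreal (g j) * indicator (D j) \<omega>) \<partial>M)"
    by (rule nn_integral_suminf[symmetric]) measurable
  also have "\<dots> = (\<integral>\<^sup>+\<omega>. ennreal (g (J (W \<omega>))) \<partial>M)"
  proof (rule nn_integral_cong)
    fix \<omega> assume \<omega>: "\<omega> \<in> space M"
    have "(\<Sum>j. ennreal (g j) * indicator (D j) \<omega>) = (\<Sum>j\<in>{J (W \<omega>)}. ennreal (g j) * indicator (D j) \<omega>)"
      using \<omega> by (intro suminf_finite) (auto simp: D_def indicator_def)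
    then show "(\<Sum>j. ennreal (g j) * indicator (D j) \<omega>) = ennreal (g (J (W \<omega>)))"
      using \<omega> by (simp add: D_def)
  qed
  finally have "emeasure M {\<omega>\<in>space M. N (\<tau> (J (W \<omega>))) \<omega> = k} = (\<integral>\<^sup>+\<omega>. ennreal (g (J (W \<omega>))) \<partial>M)" .
  then have "measure M {\<omega>\<in>space M. N (\<tau> (J (W \<omega>))) \<omega> = k} = (\<integral>\<omega>. g (J (W \<omega>)) \<partial>M)"
    by (subst integral_eq_nn_integral) (use g in \<open>auto simp: measure_def\<close>)
  then show "measure M {\<omega>\<in>space M. N (\<tau> (J (W \<omega>))) \<omega> = k}
      = (\<integral>\<omega>. \<tau> (J (W \<omega>)) ^ k / fact k * exp (- \<tau> (J (W \<omega>))) \<partial>M)"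
    by (simp add: g_def)
qed

lemma poisson_weight_le_one:
  assumes "0 \<le> (x::real)"
  shows "x ^ k / fact k * exp (- x) \<le> 1"
proof -
  have "x ^ k / fact k \<le> exp x"
    using sum_le_suminf[OF summable_exp[of x], of "{k}"] assms
    by (simp add: exp_def divide_inverse mult.commute)
  then show ?thesis by (simp add: exp_minus field_simps)
qed

text \<open>
  The times \<open>(\<lfloor>(m + 1) W\<rfloor> + 1) / (m + 1)\<close> are discrete, converge to \<open>W\<close> and are strictly
  larger than \<open>W\<close>; the strict inequality is what lets right-continuity of the paths act.
\<close>
lemma poisson_process_at_random_time:
  assumes P: "poisson_process 1 M N"
    and indep: "indep_elements M borel W (\<Pi>\<^sub>M t\<in>{0..}. count_space UNIV) (\<lambda>\<omega>. \<lambda>t\<in>{0..}. N t \<omega>)"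
    and W_nonneg: "\<And>\<omega>. \<omega> \<in> space M \<Longrightarrow> 0 \<le> W \<omega>"
  shows "(\<lambda>\<omega>. N (W \<omega>) \<omega>) \<in> measurable M (count_space UNIV)"
    and "measure M {\<omega>\<in>space M. N (W \<omega>) \<omega> = k} = (\<integral>\<omega>. W \<omega> ^ k / fact k * exp (- W \<omega>) \<partial>M)"
proof -
  interpret prob_space M using P by (simp add: poisson_process_def)
  have W [measurable]: "W \<in> borel_measurable M" using indep by (simp add: indep_elements_def)
  define J where "J = (\<lambda>m x::real. nat \<lfloor>real (Suc m) * x\<rfloor>)"
  define \<tau> where "\<tau> = (\<lambda>m j. (real j + 1) / real (Suc m))"
  define T where "T = (\<lambda>m \<omega>. \<tau> m (J m (W \<omega>)))"
  have J: "J m \<in> measurable borel (count_space UNIV)" for m unfolding J_def by measurable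
  have \<tau>: "0 < \<tau> m j" for m j by (simp add: \<tau>_def)
  have NT [measurable]: "(\<lambda>\<omega>. N (T m \<omega>) \<omega>) \<in> measurable M (count_space UNIV)" for m
    unfolding T_def by (rule poisson_process_at_discrete_time(1)[OF P indep J \<tau>])
  have NT_prob: "prob {\<omega>\<in>space M. N (T m \<omega>) \<omega> = k} = (\<integral>\<omega>. T m \<omega> ^ k / fact k * exp (- T m \<omega>) \<partial>M)" for m
    unfolding T_def by (rule poisson_process_at_discrete_time(2)[OF P indep J \<tau>])
  have T_meas [measurable]: "T m \<in> borel_measurable M" for m unfolding T_def \<tau>_def J_def by measurable
  have T_bounds: "W \<omega> < T m \<omega>" "T m \<omega> \<le> W \<omega> + 1 / real (Suc m)" if "\<omega> \<in> space M" for m \<omega>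
  proof -
    have eq: "real (J m (W \<omega>)) = of_int \<lfloor>real (Suc m) * W \<omega>\<rfloor>"
      using W_nonneg[OF that] by (simp add: J_def)
    show "W \<omega> < T m \<omega>"
      using floor_correct[of "real (Suc m) * W \<omega>"]
      by (simp add: T_def \<tau>_def eq pos_less_divide_eq mult.commute del: of_nat_Suc)
    have "T m \<omega> \<le> (real (Suc m) * W \<omega> + 1) / real (Suc m)"
      unfolding T_def \<tau>_def eq by (intro divide_right_mono add_right_mono of_int_floor_le) simp
    also have "\<dots> = W \<omega> + 1 / real (Suc m)" by (simp add: add_divide_distrib del: of_nat_Suc)
    finally show "T m \<omega> \<le> W \<omega> + 1 / real (Suc m)" .
  qed
  have T_lim: "(\<lambda>m. T m \<omega>) \<longlonglongrightarrow> W \<omega>" if "\<omega> \<in> space M" for \<omega>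
  proof (rule tendsto_sandwich[where f = "\<lambda>_. W \<omega>" and h = "\<lambda>m. W \<omega> + 1 / real (Suc m)"])
    show "(\<lambda>m. W \<omega> + 1 / real (Suc m)) \<longlonglongrightarrow> W \<omega>"
      using tendsto_add[OF tendsto_const LIMSEQ_Suc[OF lim_1_over_n], of "W \<omega>"] by simp
    show "\<forall>\<^sub>F m in sequentially. W \<omega> \<le> T m \<omega>"
      using T_bounds(1)[OF that] by (intro always_eventually allI less_imp_le)
    show "\<forall>\<^sub>F m in sequentially. T m \<omega> \<le> W \<omega> + 1 / real (Suc m)"
      using T_bounds(2)[OF that] by (intro always_eventually allI)
  qed simp
  have N_lim: "\<forall>\<^sub>F m in sequentially. N (T m \<omega>) \<omega> = N (W \<omega>) \<omega>" if \<omega>: "\<omega> \<in> space M" for \<omega>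
  proof -
    have right_cont: "((\<lambda>s. N s \<omega>) \<longlongrightarrow> N (W \<omega>) \<omega>) (at_right (W \<omega>))"
      using P \<omega> W_nonneg[OF \<omega>] by (simp add: poisson_process_def)
    have "filterlim (\<lambda>m. T m \<omega>) (at_right (W \<omega>)) sequentially"
      using T_lim[OF \<omega>] T_bounds(1)[OF \<omega>] by (intro tendsto_imp_filterlim_at_right always_eventually allI)
    from filterlim_compose[OF right_cont this] show ?thesis
      by (simp add: nhds_discrete filterlim_principal)
  qed
  have "(\<lambda>\<omega>. real (N (W \<omega>) \<omega>)) \<in> borel_measurable M"
  proof (rule borel_measurable_LIMSEQ_real)
    show "(\<lambda>m. real (N (T m \<omega>) \<omega>)) \<longlonglongrightarrow> real (N (W \<omega>) \<omega>)" if "\<omega> \<in> space M" for \<omega>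
      using N_lim[OF that] by (intro tendsto_eventually) (auto elim: eventually_mono)
    show "(\<lambda>\<omega>. real (N (T m \<omega>) \<omega>)) \<in> borel_measurable M" for m by measurable
  qed
  then have "(\<lambda>\<omega>. nat \<lfloor>real (N (W \<omega>) \<omega>)\<rfloor>) \<in> measurable M (count_space UNIV)" by measurable
  then show NW [measurable]: "(\<lambda>\<omega>. N (W \<omega>) \<omega>) \<in> measurable M (count_space UNIV)" by simp
  have "(\<lambda>m. \<integral>\<omega>. indicator {\<omega>\<in>space M. N (T m \<omega>) \<omega> = k} \<omega> \<partial>M)
      \<longlonglongrightarrow> (\<integral>\<omega>. (indicator {\<omega>\<in>space M. N (W \<omega>) \<omega> = k} \<omega> :: real) \<partial>M)"
  proof (rule integral_dominated_convergence[where w = "\<lambda>_. 1"])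
    show "AE \<omega> in M. (\<lambda>m. indicator {\<omega>\<in>space M. N (T m \<omega>) \<omega> = k} \<omega>)
        \<longlonglongrightarrow> (indicator {\<omega>\<in>space M. N (W \<omega>) \<omega> = k} \<omega> :: real)"
    proof (rule AE_I2)
      fix \<omega> assume \<omega>: "\<omega> \<in> space M"
      show "(\<lambda>m. indicator {\<omega>\<in>space M. N (T m \<omega>) \<omega> = k} \<omega>)
        \<longlonglongrightarrow> (indicator {\<omega>\<in>space M. N (W \<omega>) \<omega> = k} \<omega> :: real)"
        using N_lim[OF \<omega>] by (intro tendsto_eventually) (auto elim!: eventually_mono simp: indicator_def)
    qed
  qed (auto simp: indicator_def)
  then have "(\<lambda>m. prob {\<omega>\<in>space M. N (T m \<omega>) \<omega> = k}) \<longlonglongrightarrow> prob {\<omega>\<in>space M. N (W \<omega>) \<omega> = k}"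
    by (simp add: Int_def conj_commute conj_left_commute cong: conj_cong)
  moreover have "(\<lambda>m. \<integral>\<omega>. T m \<omega> ^ k / fact k * exp (- T m \<omega>) \<partial>M)
      \<longlonglongrightarrow> (\<integral>\<omega>. W \<omega> ^ k / fact k * exp (- W \<omega>) \<partial>M)"
  proof (rule integral_dominated_convergence[where w = "\<lambda>_. 1"])
    show "AE \<omega> in M. (\<lambda>m. T m \<omega> ^ k / fact k * exp (- T m \<omega>)) \<longlonglongrightarrow> W \<omega> ^ k / fact k * exp (- W \<omega>)"
      by (intro AE_I2 tendsto_intros T_lim) auto
    show "AE \<omega> in M. norm (T m \<omega> ^ k / fact k * exp (- T m \<omega>)) \<le> 1" for m
    proof (rule AE_I2)
      fix \<omega> assume \<omega>: "\<omega> \<in> space M"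
      have "0 \<le> T m \<omega>" using T_bounds(1)[OF \<omega>, of m] W_nonneg[OF \<omega>] by simp
      then show "norm (T m \<omega> ^ k / fact k * exp (- T m \<omega>)) \<le> 1"
        using poisson_weight_le_one[of "T m \<omega>" k] by simp
    qed
  qed auto
  ultimately show "prob {\<omega>\<in>space M. N (W \<omega>) \<omega> = k} = (\<integral>\<omega>. W \<omega> ^ k / fact k * exp (- W \<omega>) \<partial>M)"
    using NT_prob by (simp add: LIMSEQ_unique)
qed

text \<open>
  The weights \<open>W^k exp (- W) / k!\<close> are at most 1, so the geometric series dominates and justifies
  summing under the expectation.
\<close>
lemma mixed_poisson_pgf:
  fixes W :: "'a \<Rightarrow> real"
  assumes "prob_space M" and [measurable]: "W \<in> borel_measurable M"
    and W_nonneg: "\<And>\<omega>. \<omega> \<in> space M \<Longrightarrow> 0 \<le> W \<omega>" and z: "0 \<le> z" "z < 1"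
  shows "(\<Sum>k. (\<integral>\<omega>. W \<omega> ^ k / fact k * exp (- W \<omega>) \<partial>M) * z ^ k) = (\<integral>\<omega>. exp (- (1 - z) * W \<omega>) \<partial>M)"
proof -
  interpret prob_space M by fact
  define f where "f = (\<lambda>k \<omega>. W \<omega> ^ k / fact k * exp (- W \<omega>) * z ^ k)"
  have [measurable]: "f k \<in> borel_measurable M" for k unfolding f_def by measurable
  have f: "0 \<le> f k \<omega>" "f k \<omega> \<le> z ^ k" if "\<omega> \<in> space M" for k \<omega>
  proof -
    show "0 \<le> f k \<omega>" using W_nonneg[OF that] z by (simp add: f_def)
    show "f k \<omega> \<le> z ^ k"
      using mult_right_mono[OF poisson_weight_le_one[OF W_nonneg[OF that]], of "z ^ k" k] z
      by (simp add: f_def)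
  qed
  have geom: "summable (\<lambda>k. z ^ k)" using z by (intro summable_geometric) simp
  have int: "integrable M (f k)" for k
    by (rule Bochner_Integration.integrable_bound[where f = "\<lambda>_. z ^ k"])
       (use f z in auto)
  have "(\<lambda>k. integral\<^sup>L M (f k)) sums (\<integral>\<omega>. (\<Sum>k. f k \<omega>) \<partial>M)"
  proof (rule sums_integral[OF int])
    show "AE \<omega> in M. summable (\<lambda>k. norm (f k \<omega>))"
      using f by (intro AE_I2 summable_comparison_test'[OF geom]) auto
    show "summable (\<lambda>k. \<integral>\<omega>. norm (f k \<omega>) \<partial>M)"
    proof (rule summable_comparison_test'[OF geom])
      fix k
      have "(\<integral>\<omega>. norm (f k \<omega>) \<partial>M) \<le> (\<integral>\<omega>. z ^ k \<partial>M)"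
        using f int[of k] by (intro integral_mono integrable_norm) auto
      then show "norm (\<integral>\<omega>. norm (f k \<omega>) \<partial>M) \<le> z ^ k" by (simp add: prob_space)
    qed
  qed
  moreover have "(\<Sum>k. f k \<omega>) = exp (- (1 - z) * W \<omega>)" for \<omega>
  proof -
    have "(\<lambda>k. exp (- W \<omega>) * ((z * W \<omega>) ^ k /\<^sub>R fact k)) sums (exp (- W \<omega>) * exp (z * W \<omega>))"
      by (intro sums_mult exp_converges)
    also have "(\<lambda>k. exp (- W \<omega>) * ((z * W \<omega>) ^ k /\<^sub>R fact k)) = (\<lambda>k. f k \<omega>)"
      by (simp add: f_def field_simps power_mult_distrib)
    finally show ?thesis
      by (simp add: sums_iff exp_add[symmetric] algebra_simps)
  qed
  ultimately show ?thesis by (simp add: sums_iff f_def)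
qed

section \<open>The generating functions of the thinned variables\<close>

text \<open>
  Writing the power as \<open>exp (n ln (1 - y / a\<^sub>n))\<close> reduces the claim to
  \<open>ln (1 + h) / h \<longlongrightarrow> 1\<close> as \<open>h \<longlongrightarrow> 0\<close>.
\<close>
lemma scaled_power_tendsto_exp:
  fixes a :: "nat \<Rightarrow> real"
  assumes lim: "(\<lambda>n. a n / real n) \<longlonglongrightarrow> 1"
  shows "(\<lambda>n. (1 - y / a n) ^ n) \<longlonglongrightarrow> exp (- y)"
proof -
  have inv: "(\<lambda>n. real n / a n) \<longlonglongrightarrow> 1"
    using tendsto_inverse[OF lim] by (simp add: inverse_eq_divide)
  have h: "(\<lambda>n. - y / a n) \<longlonglongrightarrow> 0"
  proof -
    have "(\<lambda>n. - y * ((real n / a n) * (1 / real n))) \<longlonglongrightarrow> - y * (1 * 0)"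
      by (intro tendsto_intros inv)
    moreover have "\<forall>\<^sub>F n in sequentially. - y * ((real n / a n) * (1 / real n)) = - y / a n"
      using eventually_gt_at_top[of 0] by eventually_elim simp
    ultimately show ?thesis using Lim_transform_eventually by fastforce
  qed
  \<comment> \<open>Filling in the removable singularity covers \<open>y = 0\<close>, where \<open>h\<close> vanishes identically.\<close>
  define g where "g = (\<lambda>h::real. if h = 0 then 1 else ln (1 + h) / h)"
  have "(g \<longlongrightarrow> 1) (at 0)"
  proof -
    have "((\<lambda>h::real. ln (1 + h) / h) \<longlongrightarrow> 1) (at 0)"
      using DERIV_ln[of "1::real"] by (simp add: DERIV_def)
    then show ?thesis
      by (rule filterlim_cong[THEN iffD1, rotated -1]) (auto simp: g_def eventually_at_filter)
  qed
  then have "isCont g 0" by (simp add: isCont_def g_def)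
  then have g: "(\<lambda>n. g (- y / a n)) \<longlonglongrightarrow> 1"
    using isCont_tendsto_compose[OF _ h] by (fastforce simp: g_def)
  have "(\<lambda>n. exp (- y * (real n / a n) * g (- y / a n))) \<longlonglongrightarrow> exp (- y * 1 * 1)"
    by (intro tendsto_intros inv g)
  moreover have "\<forall>\<^sub>F n in sequentially. exp (- y * (real n / a n) * g (- y / a n)) = (1 - y / a n) ^ n"
  proof -
    have "\<forall>\<^sub>F n in sequentially. - 1 < - y / a n"
      using h by (rule order_tendstoD) simp
    then show ?thesis
    proof eventually_elim
      case (elim n)
      show ?case
      proof (cases "y / a n = 0")
        case False
        then have "- y * (real n / a n) * g (- y / a n) = real n * ln (1 - y / a n)"
          by (auto simp: g_def)
        then show ?thesis using elim by (simp add: exp_of_nat_mult)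
      qed auto
    qed
  qed
  ultimately show ?thesis using Lim_transform_eventually by fastforce
qed

lemma circ_pgf:
  assumes \<mu>: "\<mu> \<in> BB n"
  shows "(\<Sum>k. pmf (circ \<mu> n) k * z ^ k) = (\<integral>v. (1 - (1 - z) * v) ^ n \<partial>\<mu>)"
proof -
  have "(\<Sum>k. pmf (circ \<mu> n) k * z ^ k) = (\<Sum>k\<le>n. pmf (circ \<mu> n) k * z ^ k)"
    by (rule suminf_finite) (auto simp: pmf_circ[OF \<mu>] binomial_eq_0)
  also have "\<dots> = (\<Sum>k\<le>n. (\<integral>v. real (n choose k) * z ^ k * (v ^ k * (1 - v) ^ (n - k)) \<partial>\<mu>))"
    unfolding integral_mult_right_zero by (simp add: pmf_circ[OF \<mu>] mult_ac)
  also have "\<dots> = (\<integral>v. (\<Sum>k\<le>n. real (n choose k) * z ^ k * (v ^ k * (1 - v) ^ (n - k))) \<partial>\<mu>)"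
    by (rule Bochner_Integration.integral_sum[symmetric]) (auto intro: integrable_BB[OF \<mu>])
  also have "\<dots> = (\<integral>v. (z * v + (1 - v)) ^ n \<partial>\<mu>)"
    by (simp only: binomial_ring power_mult_distrib mult_ac of_nat_id)
  also have "(\<lambda>v. (z * v + (1 - v)) ^ n) = (\<lambda>v. (1 - (1 - z) * v) ^ n)"
    by (simp add: algebra_simps)
  finally show ?thesis .
qed

text \<open>
  The domination behind the exchange of limit and expectation is
  \<open>\<bar>1 - x\<bar>^n \<le> (1 + x)^n \<le> exp (n x)\<close> for \<open>x = s W / a\<^sub>n \<ge> 0\<close>, together with
  \<open>s n / a\<^sub>n < \<epsilon>\<close> for large \<open>n\<close>.
\<close>
lemma circ_scaled_pgf_tendsto:
  fixes W :: "'a \<Rightarrow> real"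
  assumes [measurable]: "W \<in> borel_measurable M"
    and W_nonneg: "\<And>\<omega>. \<omega> \<in> space M \<Longrightarrow> 0 \<le> W \<omega>"
    and a_pos: "\<And>n. 1 \<le> n \<Longrightarrow> 0 < a n"
    and a_lim: "(\<lambda>n. a n / real n) \<longlonglongrightarrow> 1"
    and BB: "\<And>n. 1 \<le> n \<Longrightarrow> distr M borel (\<lambda>\<omega>. W \<omega> / a n) \<in> BB n"
    and exp_int: "integrable M (\<lambda>\<omega>. exp (\<epsilon> * W \<omega>))"
    and z: "1 - \<epsilon> < z" "z \<le> 1"
  shows "(\<lambda>n. \<Sum>k. pmf (circ (distr M borel (\<lambda>\<omega>. W \<omega> / a n)) n) k * z ^ k)
           \<longlonglongrightarrow> (\<integral>\<omega>. exp (- (1 - z) * W \<omega>) \<partial>M)"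
proof -
  define s where "s = 1 - z"
  have s: "0 \<le> s" "s < \<epsilon>" using z by (simp_all add: s_def)
  have "(\<lambda>n. s * inverse (a n / real n)) \<longlonglongrightarrow> s * inverse 1"
    by (intro tendsto_intros a_lim) simp
  then have "\<forall>\<^sub>F n in sequentially. s * inverse (a n / real n) < \<epsilon>"
    using s by (intro order_tendstoD) auto
  then obtain n0 where n0: "\<And>n. n0 \<le> n \<Longrightarrow> s * real n / a n < \<epsilon>"
    by (auto simp: eventually_sequentially inverse_eq_divide)
  define n1 where "n1 = Suc n0"
  have "(\<lambda>n. \<integral>\<omega>. (1 - s * W \<omega> / a (n + n1)) ^ (n + n1) \<partial>M) \<longlonglongrightarrow> (\<integral>\<omega>. exp (- (s * W \<omega>)) \<partial>M)"
  proof (rule integral_dominated_convergence[where w = "\<lambda>\<omega>. exp (\<epsilon> * W \<omega>)"])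
    show "AE \<omega> in M. (\<lambda>n. (1 - s * W \<omega> / a (n + n1)) ^ (n + n1)) \<longlonglongrightarrow> exp (- (s * W \<omega>))"
      using LIMSEQ_ignore_initial_segment[OF scaled_power_tendsto_exp[OF a_lim]] by blast
    show "AE \<omega> in M. norm ((1 - s * W \<omega> / a (n + n1)) ^ (n + n1)) \<le> exp (\<epsilon> * W \<omega>)" for n
    proof (rule AE_I2)
      fix \<omega> assume \<omega>: "\<omega> \<in> space M"
      define m where "m = n + n1"
      have m: "n0 \<le> m" "1 \<le> m" by (simp_all add: m_def n1_def)
      define x where "x = s * W \<omega> / a m"
      have x: "0 \<le> x" using s W_nonneg[OF \<omega>] a_pos[OF m(2)] by (simp add: x_def)
      have "norm ((1 - x) ^ m) = \<bar>1 - x\<bar> ^ m" by (simp add: power_abs)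
      also have "\<dots> \<le> exp x ^ m" using x exp_ge_add_one_self[of x] by (intro power_mono) linarith+
      also have "\<dots> = exp (s * real m / a m * W \<omega>)" by (simp add: x_def mult_ac flip: exp_of_nat_mult)
      also have "\<dots> \<le> exp (\<epsilon> * W \<omega>)"
        using mult_right_mono[OF less_imp_le[OF n0[OF m(1)]] W_nonneg[OF \<omega>]] by simp
      finally show "norm ((1 - s * W \<omega> / a (n + n1)) ^ (n + n1)) \<le> exp (\<epsilon> * W \<omega>)"
        by (simp add: x_def m_def)
    qed
  qed (use exp_int in auto)
  then have "(\<lambda>n. \<integral>\<omega>. (1 - s * W \<omega> / a n) ^ n \<partial>M) \<longlonglongrightarrow> (\<integral>\<omega>. exp (- (s * W \<omega>)) \<partial>M)"
    by (rule LIMSEQ_offset)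
  moreover have "\<forall>\<^sub>F n in sequentially. (\<integral>\<omega>. (1 - s * W \<omega> / a n) ^ n \<partial>M)
      = (\<Sum>k. pmf (circ (distr M borel (\<lambda>\<omega>. W \<omega> / a n)) n) k * z ^ k)"
    using eventually_ge_at_top[of 1]
    by eventually_elim (simp add: circ_pgf[OF BB] integral_distr s_def)
  ultimately have "(\<lambda>n. \<Sum>k. pmf (circ (distr M borel (\<lambda>\<omega>. W \<omega> / a n)) n) k * z ^ k)
      \<longlonglongrightarrow> (\<integral>\<omega>. exp (- (s * W \<omega>)) \<partial>M)"
    by (rule Lim_transform_eventually)
  then show ?thesis by (simp only: s_def minus_mult_left)
qed

section \<open>The limit theorem\<close>

theorem theorem20:
  fixes M :: "'a measure" and W :: "'a \<Rightarrow> real" and N :: "real \<Rightarrow> 'a \<Rightarrow> nat" and a :: "nat \<Rightarrow> real"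
  assumes "prob_space M"
    and "W \<in> borel_measurable M"
    and "\<forall>\<omega>\<in>space M. 0 \<le> W \<omega>"
    and "\<forall>n\<ge>1. 0 < a n"
    and "(\<lambda>n. a n / real n) \<longlonglongrightarrow> 1"
    and "\<forall>n\<ge>1. distr M borel (\<lambda>\<omega>. W \<omega> / a n) \<in> BB n"
    and "\<exists>\<epsilon>>0. integrable M (\<lambda>\<omega>. exp (\<epsilon> * W \<omega>))"
    and "poisson_process 1 M N"
    and "indep_elements M borel W (\<Pi>\<^sub>M t\<in>{0..}. count_space UNIV) (\<lambda>\<omega>. \<lambda>t\<in>{0..}. N t \<omega>)"
  shows "weak_conv_m
           (\<lambda>n. distr (measure_pmf (circ (distr M borel (\<lambda>\<omega>. W \<omega> / a n)) n)) borel real)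
           (distr M borel (\<lambda>\<omega>. real (N (W \<omega>) \<omega>)))"
proof (rule weak_conv_m_nat_valued)
  interpret prob_space M by fact
  have W_nonneg: "0 \<le> W \<omega>" if "\<omega> \<in> space M" for \<omega> using assms(3) that by blast
  show "(\<lambda>\<omega>. N (W \<omega>) \<omega>) \<in> measurable M (count_space UNIV)"
    using assms(8,9) W_nonneg by (rule poisson_process_at_random_time)
  have law: "prob {\<omega>\<in>space M. N (W \<omega>) \<omega> = k} = (\<integral>\<omega>. W \<omega> ^ k / fact k * exp (- W \<omega>) \<partial>M)" for k
    using assms(8,9) W_nonneg by (rule poisson_process_at_random_time)
  obtain \<epsilon> where \<epsilon>: "0 < \<epsilon>" "integrable M (\<lambda>\<omega>. exp (\<epsilon> * W \<omega>))" using assms(7) by blast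
  show "(\<lambda>n. pmf (circ (distr M borel (\<lambda>\<omega>. W \<omega> / a n)) n) k) \<longlonglongrightarrow> prob {\<omega>\<in>space M. N (W \<omega>) \<omega> = k}" for k
  proof (rule power_series_convergence_imp_coefficient_convergence[where u = "max 0 (1 - \<epsilon>)" and v = 1])
    fix z :: real assume z: "max 0 (1 - \<epsilon>) < z" "z < 1"
    have "(\<Sum>k. prob {\<omega>\<in>space M. N (W \<omega>) \<omega> = k} * z ^ k) = (\<integral>\<omega>. exp (- (1 - z) * W \<omega>) \<partial>M)"
      unfolding law using z by (intro mixed_poisson_pgf assms(1,2) W_nonneg) auto
    then show "(\<lambda>n. \<Sum>k. pmf (circ (distr M borel (\<lambda>\<omega>. W \<omega> / a n)) n) k * z ^ k)
        \<longlonglongrightarrow> (\<Sum>k. prob {\<omega>\<in>space M. N (W \<omega>) \<omega> = k} * z ^ k)"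
      using circ_scaled_pgf_tendsto[OF assms(2) W_nonneg _ assms(5) _ \<epsilon>(2), of z] assms(4,6) z by simp
  qed (use \<epsilon>(1) in \<open>auto simp: pmf_le_1\<close>)
qed fact

end
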